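(* Suppose that $\mathcal E_p$ is a superexpectation for all $p\in\mathcal P$. Let $\delta\in[0,1)$ and let $\Phi$ be a $\delta$-mixing forecasting system. If $E\subseteq\mathcal X^\infty$ is a tail set, then $\overline{\mathbb P}_\Phi(E)=0$ or $\overline{\mathbb P}_\Phi(E)\ge1-\delta$.
   Context: Conventions: $\mathbb N=\{1,2,\ldots\}$, $\overline{\mathbb R}=[-\infty,\infty]$, $0\times\infty:=0$ and $\infty+(-\infty):=\infty$; "positive" means $\ge0$. $\mathbb I_E$ denotes the indicator function of $E$. For a non-empty set $X$, an outer probability content on $X$ is a function $\mathcal E:\overline{\mathbb R}^X\to\overline{\mathbb R}$ such that: (1) $f\le g$ implies $\mathcal E(f)\le\mathcal E(g)$; (2) $\mathcal E(cf)=c\,\mathcal E(f)$ for all $f$ and $c\in(0,\infty)$; (3) $\mathcal E(f+g)\le\mathcal E(f)+\mathcal E(g)$ for all $f,g$; (4) $\mathcal E(c)=c$ for every $c\in\mathbb R$ (the argument being the constant function $c$). It is a superexpectation if, in addition, (5) $\mathcal E(\sum_{k=1}^\infty f_k)\le\sum_{k=1}^\infty\mathcal E(f_k)$ for every sequence of positive functions $f_1,f_2,\ldots\in\overline{\mathbb R}^X$. Setting (prediction with Forecaster): fixed are a non-empty set $\mathcal X$, non-empty sets $\mathcal P_1,\mathcal P_2,\ldots$ with $\mathcal P:=\bigcup_n\mathcal P_n$, and a map assigning to each $p\in\mathcal P$ an outer probability content $\mathcal E_p$ on $\mathcal X$. The sample space is $\Omega:=\prod_{n=1}^\infty(\mathcal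 P_n\times\mathcal X)$. Clearing situations are elements of $\bigcup_{n\ge0}\prod_{i=1}^n(\mathcal P_i\times\mathcal X)$; the level of $p_1x_1\ldots p_nx_n$ is $n$; $\Box$ is the empty one. For a clearing situation $s$, $\Gamma(s)\subseteq\Omega$ is the set of its infinite extensions; for $\omega\in\Omega$, $\omega^n$ is the prefix of $\omega$ that is a clearing situation of level $n$. A supermartingale is a function $\mathcal S$ from clearing situations to $\overline{\mathbb R}$ such that $\mathcal E_p(\mathcal S(sp\,\cdot))\le\mathcal S(s)$ for every $n\in\mathbb N$, every clearing situation $s$ of level $n-1$ and every $p\in\mathcal P_n$, where $\mathcal S(sp\,\cdot)$ is $x\mapsto\mathcal S(spx)$; it is bounded below if $\inf\mathcal S>-\infty$. For $\xi:\Omega\to\overline{\mathbb R}$, $$\overline{\mathbb E}(\xi\mid s):=\inf\bigl\{\mathcal S(s)\bigm|\liminf_{n\to\infty}\mathcal S(\omega^n)\ge\xi(\omega)\text{ for all }\omega\in\Gamma(s)\bigr\},$$ $\mathcal S$ ranging over bounded below supermartingales. For $A\subseteq\Omega$, $\overline{\mathbb P}(A\mid s):=\overline{\mathbb E}(\mathbb I_A\mid s)$. For $\chi=x_1x_2\ldots\in\mathcal X^\infty$: $\chi_n:=x_n$ and $\chi^n:=x_1\ldots x_n\in\mathcal X^n$ ($\chi^0=\Box$ is the empty sequence). Let $\mathcal X^*=\bigcup_{n\ge0}\mathcal X^n$. A forecasting system is a function $\Phi:\mathcal X^*\to\mathcal P$ with $\Phi(\chi^{n-1})\in\mathcal P_n$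 for all $\chi\in\mathcal X^\infty$, $n\in\mathbb N$. Put $\chi_\Phi:=\Phi(\Box)\chi_1\Phi(\chi^1)\chi_2\Phi(\chi^2)\chi_3\ldots\in\Omega$ and, for $E\subseteq\mathcal X^\infty$, $E_\Phi:=\{\chi_\Phi\mid\chi\in E\}$. Define $\overline{\mathbb P}_\Phi(E\mid\chi^n):=\overline{\mathbb P}(E_\Phi\mid(\chi_\Phi)^n)$ and $\overline{\mathbb P}_\Phi(E):=\overline{\mathbb P}_\Phi(E\mid\Box)=\overline{\mathbb P}(E_\Phi\mid\Box)$. A property $E\subseteq\mathcal X^\infty$ of $\chi$ holds $\Phi$-almost surely ($\Phi$-a.s.) if $\overline{\mathbb P}_\Phi(E^c)=0$, where $E^c=\mathcal X^\infty\setminus E$. For $N\in\mathbb N$, $\mathcal F_N$ is the set of all $E\subseteq\mathcal X^\infty$ such that for all $\chi,\chi'\in\mathcal X^\infty$: if $\chi\in E$ and $\chi'_n=\chi_n$ for all $n\ge N$, then $\chi'\in E$. A tail set is an element of $\bigcap_N\mathcal F_N$. A forecasting system $\Phi$ is $\delta$-mixing if there is a function $a:\mathbb N\to\mathbb N$ such that, for each $n\in\mathbb N$ and each $E\in\mathcal F_{n+a(n)}$, $\overline{\mathbb P}_\Phi(E\mid\chi^n)-\overline{\mathbb P}_\Phi(E)\le\delta$ holds $\Phi$-a.s. (as a property of $\chi$). *)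

theory Defs
  imports "HOL-Library.Extended_Real" "HOL-Library.Indicator_Function"
begin

text \<open>
  Infinite sequences are functions on \<^typ>\<open>nat\<close> and are indexed from 0: \<open>\<chi> i\<close> and \<open>\<P> i\<close> stand for
  $\chi_{i+1}$ and $\mathcal P_{i+1}$.  The space $\mathcal X$ is a type.  Clearing situations are
  lists of pairs $(p_i, x_i)$, and their level is the length of the list.
  The arithmetic of \<^typ>\<open>ereal\<close> satisfies \<open>0 * \<infinity> = 0\<close> and \<open>\<infinity> + (-\<infinity>) = \<infinity>\<close>.
\<close>

definition outer_prob_content :: "(('x \<Rightarrow> ereal) \<Rightarrow> ereal) \<Rightarrow> bool" where
  "outer_prob_content E \<longleftrightarrow>
     (\<forall>f g. (\<forall>x. f x \<le> g x) \<longrightarrow> E f \<le> E g) \<and>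
     (\<forall>f. \<forall>c::real. 0 < c \<longrightarrow> E (\<lambda>x. ereal c * f x) = ereal c * E f) \<and>
     (\<forall>f g. E (\<lambda>x. f x + g x) \<le> E f + E g) \<and>
     (\<forall>c::real. E (\<lambda>_. ereal c) = ereal c)"

definition superexpectation :: "(('x \<Rightarrow> ereal) \<Rightarrow> ereal) \<Rightarrow> bool" where
  "superexpectation E \<longleftrightarrow> outer_prob_content E \<and>
     (\<forall>f :: nat \<Rightarrow> 'x \<Rightarrow> ereal. (\<forall>k x. 0 \<le> f k x) \<longrightarrow>
        E (\<lambda>x. \<Sum>k. f k x) \<le> (\<Sum>k. E (f k)))"

definition initial :: "(nat \<Rightarrow> 'a) \<Rightarrow> nat \<Rightarrow> 'a list" where
  "initial \<omega> n = map \<omega> [0..<n]"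

definition sample_space :: "(nat \<Rightarrow> 'p set) \<Rightarrow> (nat \<Rightarrow> 'p \<times> 'x) set" where
  "sample_space \<P> = {\<omega>. \<forall>i. \<omega> i \<in> \<P> i \<times> UNIV}"

definition clearing_situations :: "(nat \<Rightarrow> 'p set) \<Rightarrow> ('p \<times> 'x) list set" where
  "clearing_situations \<P> = {s. \<forall>i < length s. s ! i \<in> \<P> i \<times> UNIV}"

definition extensions :: "(nat \<Rightarrow> 'p set) \<Rightarrow> ('p \<times> 'x) list \<Rightarrow> (nat \<Rightarrow> 'p \<times> 'x) set" where
  "extensions \<P> s = {\<omega> \<in> sample_space \<P>. initial \<omega> (length s) = s}"

text \<open>
  Only the values on clearing situations matter; the values of \<open>S\<close> on other lists are unconstrained
  and never used.
\<close>

definition supermartingale ::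
  "(nat \<Rightarrow> 'p set) \<Rightarrow> ('p \<Rightarrow> ('x \<Rightarrow> ereal) \<Rightarrow> ereal) \<Rightarrow> (('p \<times> 'x) list \<Rightarrow> ereal) \<Rightarrow> bool" where
  "supermartingale \<P> \<E> S \<longleftrightarrow>
     (\<forall>s \<in> clearing_situations \<P>. \<forall>p \<in> \<P> (length s). \<E> p (\<lambda>x. S (s @ [(p, x)])) \<le> S s)"

definition bounded_below :: "(nat \<Rightarrow> 'p set) \<Rightarrow> (('p \<times> 'x) list \<Rightarrow> ereal) \<Rightarrow> bool" where
  "bounded_below \<P> S \<longleftrightarrow> (INF s \<in> clearing_situations \<P>. S s) > -\<infinity>"

definition upper_expectation ::
  "(nat \<Rightarrow> 'p set) \<Rightarrow> ('p \<Rightarrow> ('x \<Rightarrow> ereal) \<Rightarrow> ereal) \<Rightarrow>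
   ((nat \<Rightarrow> 'p \<times> 'x) \<Rightarrow> ereal) \<Rightarrow> ('p \<times> 'x) list \<Rightarrow> ereal" where
  "upper_expectation \<P> \<E> \<xi> s =
     Inf {S s | S. supermartingale \<P> \<E> S \<and> bounded_below \<P> S \<and>
                   (\<forall>\<omega> \<in> extensions \<P> s. liminf (\<lambda>n. S (initial \<omega> n)) \<ge> \<xi> \<omega>)}"

definition upper_prob ::
  "(nat \<Rightarrow> 'p set) \<Rightarrow> ('p \<Rightarrow> ('x \<Rightarrow> ereal) \<Rightarrow> ereal) \<Rightarrow>
   (nat \<Rightarrow> 'p \<times> 'x) set \<Rightarrow> ('p \<times> 'x) list \<Rightarrow> ereal" where
  "upper_prob \<P> \<E> A s = upper_expectation \<P> \<E> (indicator A) s"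

definition forecasting_system :: "(nat \<Rightarrow> 'p set) \<Rightarrow> ('x list \<Rightarrow> 'p) \<Rightarrow> bool" where
  "forecasting_system \<P> \<Phi> \<longleftrightarrow> (\<forall>\<chi> n. \<Phi> (initial \<chi> n) \<in> \<P> n)"

definition with_forecasts :: "('x list \<Rightarrow> 'p) \<Rightarrow> (nat \<Rightarrow> 'x) \<Rightarrow> (nat \<Rightarrow> 'p \<times> 'x)" where
  "with_forecasts \<Phi> \<chi> = (\<lambda>i. (\<Phi> (initial \<chi> i), \<chi> i))"

text \<open>The conditional upper probability $\overline{\mathbb P}_\Phi(A \mid \chi^n)$.\<close>

definition upper_prob_forecast_cond ::
  "(nat \<Rightarrow> 'p set) \<Rightarrow> ('p \<Rightarrow> ('x \<Rightarrow> ereal) \<Rightarrow> ereal) \<Rightarrow> ('x list \<Rightarrow> 'p) \<Rightarrow>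
   (nat \<Rightarrow> 'x) set \<Rightarrow> (nat \<Rightarrow> 'x) \<Rightarrow> nat \<Rightarrow> ereal" where
  "upper_prob_forecast_cond \<P> \<E> \<Phi> A \<chi> n =
     upper_prob \<P> \<E> (with_forecasts \<Phi> ` A) (initial (with_forecasts \<Phi> \<chi>) n)"

definition upper_prob_forecast ::
  "(nat \<Rightarrow> 'p set) \<Rightarrow> ('p \<Rightarrow> ('x \<Rightarrow> ereal) \<Rightarrow> ereal) \<Rightarrow> ('x list \<Rightarrow> 'p) \<Rightarrow>
   (nat \<Rightarrow> 'x) set \<Rightarrow> ereal" where
  "upper_prob_forecast \<P> \<E> \<Phi> A = upper_prob \<P> \<E> (with_forecasts \<Phi> ` A) []"

definition almost_surely ::
  "(nat \<Rightarrow> 'p set) \<Rightarrow> ('p \<Rightarrow> ('x \<Rightarrow> ereal) \<Rightarrow> ereal) \<Rightarrow> ('x list \<Rightarrow> 'p) \<Rightarrow>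
   (nat \<Rightarrow> 'x) set \<Rightarrow> bool" where
  "almost_surely \<P> \<E> \<Phi> A \<longleftrightarrow> upper_prob_forecast \<P> \<E> \<Phi> (- A) = 0"

text \<open>
  The index \<open>N\<close> is the one of $\mathcal F_N$, i.e. it counts coordinates from 1, so the sets in
  \<open>tail_from N\<close> are those determined by the coordinates \<open>\<chi> i\<close> with \<open>i + 1 \<ge> N\<close>.
\<close>

definition tail_from :: "nat \<Rightarrow> (nat \<Rightarrow> 'x) set set" where
  "tail_from N = {A. \<forall>\<chi> \<chi>'. \<chi> \<in> A \<longrightarrow> (\<forall>i. Suc i \<ge> N \<longrightarrow> \<chi>' i = \<chi> i) \<longrightarrow> \<chi>' \<in> A}"

definition tail_set :: "(nat \<Rightarrow> 'x) set \<Rightarrow> bool" where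
  "tail_set A \<longleftrightarrow> A \<in> (\<Inter>N \<in> {1..}. tail_from N)"

definition delta_mixing ::
  "(nat \<Rightarrow> 'p set) \<Rightarrow> ('p \<Rightarrow> ('x \<Rightarrow> ereal) \<Rightarrow> ereal) \<Rightarrow> real \<Rightarrow> ('x list \<Rightarrow> 'p) \<Rightarrow> bool" where
  "delta_mixing \<P> \<E> \<delta> \<Phi> \<longleftrightarrow>
     (\<exists>a :: nat \<Rightarrow> nat. (\<forall>n \<ge> 1. a n \<ge> 1) \<and>
        (\<forall>n \<ge> 1. \<forall>A \<in> tail_from (n + a n).
           almost_surely \<P> \<E> \<Phi>
             {\<chi>. upper_prob_forecast_cond \<P> \<E> \<Phi> A \<chi> n - upper_prob_forecast \<P> \<E> \<Phi> A \<le> ereal \<delta>}))"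

end

theory Submission
  imports Defs
begin

text \<open>
  Suppose that the upper probability of \<open>A\<close> is less than \<open>1 - \<delta>\<close>.  By mixing, outside a null set the
  conditional upper probabilities of \<open>A\<close> stay below some \<open>r < 1\<close>.  The set \<open>N\<close> of the paths in \<open>A\<close>
  on which this happens is null: let \<open>q\<close> be the supremum over all situations \<open>s\<close> of the upper
  probability of \<open>N\<close> given \<open>s\<close>.  Starting from less than \<open>r' \<in> (r, 1)\<close> at \<open>s\<close> one can force the
  capital to exceed a given \<open>\<rho> \<in> (r', 1)\<close> at some time on every path in \<open>N\<close>, and from that time on
  hedge \<open>N\<close> afresh at a price close to \<open>q\<close>.  Hence \<open>q \<le> q * r' / \<rho>\<close>, that is, \<open>q = 0\<close>.
\<close>

subsection \<open>Clearing situations\<close>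

lemma length_initial [simp]: "length (initial \<omega> n) = n"
  by (simp add: initial_def)

lemma take_initial: "k \<le> n \<Longrightarrow> take k (initial \<omega> n) = initial \<omega> k"
  by (simp add: initial_def take_map)

lemma clearing_Nil [simp]: "[] \<in> clearing_situations \<P>"
  by (simp add: clearing_situations_def)

lemma clearing_snoc:
  "s @ [(p, x)] \<in> clearing_situations \<P> \<longleftrightarrow> s \<in> clearing_situations \<P> \<and> p \<in> \<P> (length s)"
  by (auto simp: clearing_situations_def nth_append less_Suc_eq)

lemma clearing_take: "s \<in> clearing_situations \<P> \<Longrightarrow> take k s \<in> clearing_situations \<P>"
  by (auto simp: clearing_situations_def)

lemma clearing_initial: "\<omega> \<in> sample_space \<P> \<Longrightarrow> initial \<omega> n \<in> clearing_situations \<P>"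
  by (auto simp: clearing_situations_def sample_space_def initial_def)

lemma extensions_initial:
  "\<omega> \<in> sample_space \<P> \<Longrightarrow> \<omega> \<in> extensions \<P> (initial \<omega> n)"
  by (simp add: extensions_def)

text \<open>The equation \<open>take (length s) t = s\<close> encodes that \<open>s\<close> is a
  prefix of \<open>t\<close>; comparing lengths, it excludes a \<open>t\<close> shorter than
  \<open>s\<close>.\<close>

lemma extensions_antimono:
  assumes "take (length s) t = s"
  shows "extensions \<P> t \<subseteq> extensions \<P> s"
proof
  fix \<omega> assume \<omega>: "\<omega> \<in> extensions \<P> t"
  have "length s \<le> length t"
    using arg_cong[OF assms, of length] by simp
  then have "initial \<omega> (length s) = take (length s) t"
    using \<omega> take_initial[of "length s" "length t" \<omega>] by (simp add: extensions_def)
  then show "\<omega> \<in> extensions \<P> s"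
    using \<omega> assms by (simp add: extensions_def)
qed

subsection \<open>Supermartingales and upper probability\<close>

lemma outer_prob_content_mono:
  "outer_prob_content E \<Longrightarrow> (\<And>x. f x \<le> g x) \<Longrightarrow> E f \<le> E g"
  by (auto simp: outer_prob_content_def)

lemma outer_prob_content_scale:
  "outer_prob_content E \<Longrightarrow> 0 < c \<Longrightarrow> E (\<lambda>x. ereal c * f x) = ereal c * E f"
  by (auto simp: outer_prob_content_def)

lemma outer_prob_content_const:
  "outer_prob_content E \<Longrightarrow> E (\<lambda>_. ereal c) = ereal c"
  by (auto simp: outer_prob_content_def)

lemma supermartingaleI:
  assumes "\<And>s p. s \<in> clearing_situations \<P> \<Longrightarrow> p \<in> \<P> (length s) \<Longrightarrow> \<E> p (\<lambda>x. S (s @ [(p, x)])) \<le> S s"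
  shows "supermartingale \<P> \<E> S"
  using assms by (auto simp: supermartingale_def)

lemma supermartingaleD:
  "supermartingale \<P> \<E> S \<Longrightarrow> s \<in> clearing_situations \<P> \<Longrightarrow> p \<in> \<P> (length s) \<Longrightarrow>
    \<E> p (\<lambda>x. S (s @ [(p, x)])) \<le> S s"
  by (auto simp: supermartingale_def)

lemma bounded_belowI:
  assumes "\<And>s. s \<in> clearing_situations \<P> \<Longrightarrow> 0 \<le> S s"
  shows "bounded_below \<P> S"
proof -
  have "0 \<le> (INF s \<in> clearing_situations \<P>. S s)"
    using assms by (intro INF_greatest)
  then show ?thesis
    unfolding bounded_below_def using less_le_trans[of "-\<infinity>" "0::ereal"] by auto
qed

text \<open>Nonnegativity of \<open>S\<close> settles the lower bound and all paths outside
  \<open>N\<close>, where the indicator is 0; so a hedge has to be checked on \<open>N\<close>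
  only.\<close>

lemma upper_prob_le:
  assumes "supermartingale \<P> \<E> S"
    and nonneg: "\<And>t. t \<in> clearing_situations \<P> \<Longrightarrow> 0 \<le> S t"
    and ge_1: "\<And>\<omega>. \<omega> \<in> extensions \<P> s \<Longrightarrow> \<omega> \<in> N \<Longrightarrow> 1 \<le> liminf (\<lambda>n. S (initial \<omega> n))"
  shows "upper_prob \<P> \<E> N s \<le> S s"
proof -
  have "indicator N \<omega> \<le> liminf (\<lambda>n. S (initial \<omega> n))" if "\<omega> \<in> extensions \<P> s" for \<omega>
  proof (cases "\<omega> \<in> N")
    case False
    have "0 \<le> liminf (\<lambda>n. S (initial \<omega> n))"
      using that by (intro Liminf_bounded always_eventually allI nonneg clearing_initial)
        (simp add: extensions_def)
    then show ?thesis using False by simp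
  qed (use that ge_1 in simp)
  then show ?thesis
    unfolding upper_prob_def upper_expectation_def
    using assms(1) bounded_belowI[of \<P> S] nonneg by (intro Inf_lower) auto
qed

locale forecasting_game =
  fixes \<P> :: "nat \<Rightarrow> 'p set" and \<E> :: "'p \<Rightarrow> ('x \<Rightarrow> ereal) \<Rightarrow> ereal"
  assumes nonempty: "\<P> n \<noteq> {}"
    and content: "p \<in> \<P> n \<Longrightarrow> outer_prob_content (\<E> p)"
begin

text \<open>If \<open>S u < c\<close> but every outcome after a forecast led to a value of at least
  \<open>c\<close>, monotonicity and the value of \<open>\<E> p\<close> on constants would give
  \<open>c \<le> S u\<close>. So some outcome keeps \<open>S\<close> below \<open>c\<close>, and
  dependent choice strings such outcomes together.\<close>

lemma supermartingale_path:
  assumes S: "supermartingale \<P> \<E> S" and t: "t \<in> clearing_situations \<P>" and "S t < ereal c"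
  obtains \<omega> where "\<omega> \<in> extensions \<P> t" "\<And>n. length t \<le> n \<Longrightarrow> S (initial \<omega> n) < ereal c"
proof -
  define good where "good n u \<longleftrightarrow> u \<in> clearing_situations \<P> \<and> S u < ereal c \<and>
      length u = length t + n \<and> take (length t) u = t" for n u
  have "\<exists>f. \<forall>n. good n (f n) \<and> (\<exists>a. f (Suc n) = f n @ [a])"
  proof (rule dependent_nat_choice)
    show "\<exists>u. good 0 u" using assms by (auto simp: good_def)
  next
    fix u n assume u: "good n u"
    \<comment> \<open>Any forecast will do, since the supermartingale inequality holds for all of
      them.\<close>
    obtain p where p: "p \<in> \<P> (length u)" using nonempty by blast
    have "\<exists>x. S (u @ [(p, x)]) < ereal c"
    proof (rule ccontr)
      assume "\<not> ?thesis"
      then have "ereal c \<le> S (u @ [(p, x)])" for x by (simp add: not_less)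
      then have "\<E> p (\<lambda>_. ereal c) \<le> \<E> p (\<lambda>x. S (u @ [(p, x)]))"
        by (rule outer_prob_content_mono[OF content[OF p]])
      also have "\<dots> \<le> S u"
        using supermartingaleD[OF S, of u p] u p by (simp add: good_def)
      finally show False
        using u outer_prob_content_const[OF content[OF p]] by (auto simp: good_def)
    qed
    then obtain x where "S (u @ [(p, x)]) < ereal c" ..
    then have "good (Suc n) (u @ [(p, x)])"
      using u p by (simp add: good_def clearing_snoc)
    then show "\<exists>v. good (Suc n) v \<and> (\<exists>a. v = u @ [a])" by blast
  qed
  then obtain f where good: "\<And>n. good n (f n)" and snoc: "\<And>n. \<exists>a. f (Suc n) = f n @ [a]"
    by blast
  have len: "length (f n) = length t + n" for n using good by (simp add: good_def)
  have prefix: "take (length (f m)) (f n) = f m" if "m \<le> n" for m n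
    using that
  proof (induction rule: dec_induct)
    case (step n)
    obtain a where "f (Suc n) = f n @ [a]" using snoc by blast
    then show ?case using step len by simp
  qed simp
  \<comment> \<open>\<open>f (Suc i)\<close> is the first stage sure to have an entry at position
    \<open>i\<close>, even if \<open>t\<close> is empty.\<close>
  define \<omega> where "\<omega> i = f (Suc i) ! i" for i
  have nth: "f n ! i = \<omega> i" if "i < length (f n)" for n i
  proof (cases "n \<le> Suc i")
    case True
    then show ?thesis using prefix[OF True] nth_take[OF that, of "f (Suc i)"] by (simp add: \<omega>_def)
  next
    case False
    then show ?thesis
      using prefix[of "Suc i" n] nth_take[of i "length (f (Suc i))" "f n"] by (simp add: \<omega>_def len)
  qed
  have init: "initial \<omega> (length t + n) = f n" for n
    by (rule nth_equalityI) (auto simp: len nth initial_def)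
  show ?thesis
  proof
    have "\<omega> i \<in> \<P> i \<times> UNIV" for i
    proof -
      have "f (Suc i) ! i \<in> \<P> i \<times> UNIV"
        using good[of "Suc i"] by (simp add: good_def clearing_situations_def)
      then show ?thesis using nth[of i "Suc i"] by (simp add: len)
    qed
    then show "\<omega> \<in> extensions \<P> t"
      using init[of 0] good[of 0] by (auto simp: extensions_def sample_space_def good_def)
    fix n assume "length t \<le> n"
    then show "S (initial \<omega> n) < ereal c"
      using init[of "n - length t"] good[of "n - length t"] by (simp add: good_def)
  qed
qed

text \<open>A negative \<open>S t\<close> leaves room for some \<open>c\<close> with
  \<open>S t < c < 0\<close>, and a path along which \<open>S\<close> stays below \<open>c\<close>
  has a negative lower limit.\<close>

lemma supermartingale_nonneg:
  assumes "supermartingale \<P> \<E> S" "t \<in> clearing_situations \<P>"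
    and "\<And>\<omega>. \<omega> \<in> extensions \<P> t \<Longrightarrow> 0 \<le> liminf (\<lambda>n. S (initial \<omega> n))"
  shows "0 \<le> S t"
proof (rule ccontr)
  assume "\<not> 0 \<le> S t"
  then obtain c where c: "S t < ereal c" "c < 0"
    using ereal_dense2[of "S t" 0] by (auto simp: not_le zero_ereal_def)
  obtain \<omega> where \<omega>: "\<omega> \<in> extensions \<P> t" "\<And>n. length t \<le> n \<Longrightarrow> S (initial \<omega> n) < ereal c"
    using supermartingale_path[OF assms(1,2) c(1)] by blast
  have "liminf (\<lambda>n. S (initial \<omega> n)) \<le> liminf (\<lambda>_. ereal c)"
    by (rule Liminf_mono) (use \<omega>(2) in \<open>auto simp: eventually_sequentially intro: less_imp_le\<close>)
  then have "liminf (\<lambda>n. S (initial \<omega> n)) \<le> ereal c"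
    by (simp add: Liminf_const)
  with assms(3)[OF \<omega>(1)] c(2) show False
    by (metis leD order.trans ereal_less_eq(3) zero_ereal_def)
qed

text \<open>Indicators are nonnegative, so every supermartingale competing in the infimum is
  nonnegative at \<open>t\<close>.\<close>

lemma upper_prob_nonneg:
  assumes "t \<in> clearing_situations \<P>"
  shows "0 \<le> upper_prob \<P> \<E> N t"
  unfolding upper_prob_def upper_expectation_def
proof (rule Inf_greatest, clarify)
  fix S assume S: "supermartingale \<P> \<E> S"
    "\<forall>\<omega>\<in>extensions \<P> t. indicator N \<omega> \<le> liminf (\<lambda>n. S (initial \<omega> n))"
  show "0 \<le> S t"
  proof (rule supermartingale_nonneg[OF S(1) assms])
    fix \<omega> assume "\<omega> \<in> extensions \<P> t"
    moreover have "(0::ereal) \<le> indicator N \<omega>" by (simp add: indicator_def)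
    ultimately show "0 \<le> liminf (\<lambda>n. S (initial \<omega> n))"
      using S(2) order_trans by blast
  qed
qed

lemma supermartingale_const: "supermartingale \<P> \<E> (\<lambda>_. ereal c)"
  by (intro supermartingaleI) (simp add: outer_prob_content_const[OF content])

lemma upper_prob_le_1: "upper_prob \<P> \<E> N t \<le> 1"
proof (rule upper_prob_le)
  show "supermartingale \<P> \<E> (\<lambda>_. 1)"
    using supermartingale_const[of 1] by (simp add: one_ereal_def)
qed (auto simp: Liminf_const)

text \<open>
  The witness may be taken nonnegative everywhere: it is automatically so after \<open>s\<close>, and it can be
  set to \<open>\<infinity>\<close> in the situations that do not extend \<open>s\<close>.
\<close>

lemma upper_prob_lessE:
  assumes "upper_prob \<P> \<E> N s < c"
  obtains S where "supermartingale \<P> \<E> S" "\<And>t. t \<in> clearing_situations \<P> \<Longrightarrow> 0 \<le> S t" "S s < c"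
    "\<And>\<omega>. \<omega> \<in> extensions \<P> s \<Longrightarrow> \<omega> \<in> N \<Longrightarrow> 1 \<le> liminf (\<lambda>n. S (initial \<omega> n))"
proof -
  obtain S where S: "supermartingale \<P> \<E> S" "S s < c"
    and lim: "\<And>\<omega>. \<omega> \<in> extensions \<P> s \<Longrightarrow> indicator N \<omega> \<le> liminf (\<lambda>n. S (initial \<omega> n))"
    using assms unfolding upper_prob_def upper_expectation_def Inf_less_iff by blast
  define S' where "S' t = (if take (length s) t = s then S t else \<infinity>)" for t
  show ?thesis
  proof
    show "supermartingale \<P> \<E> S'"
    proof (rule supermartingaleI)
      fix t :: "('p \<times> 'x) list" and p
      assume t: "t \<in> clearing_situations \<P>" "p \<in> \<P> (length t)"
      \<comment> \<open>Once a situation extends \<open>s\<close>, so do its successors. Otherwise,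
        also when \<open>t\<close> is a proper prefix of \<open>s\<close>, the right-hand side is
        \<open>\<infinity>\<close>.\<close>
      show "\<E> p (\<lambda>x. S' (t @ [(p, x)])) \<le> S' t"
      proof (cases "take (length s) t = s")
        case True
        then have "length s \<le> length t" by (metis length_take min.cobounded1)
        then show ?thesis using True supermartingaleD[OF S(1) t] by (simp add: S'_def)
      qed (simp add: S'_def)
    qed
    show "S' s < c" using S by (simp add: S'_def)
    fix \<omega> assume \<omega>: "\<omega> \<in> extensions \<P> s" "\<omega> \<in> N"
    have "liminf (\<lambda>n. S (initial \<omega> n)) \<le> liminf (\<lambda>n. S' (initial \<omega> n))"
      by (intro Liminf_mono always_eventually) (simp add: S'_def)
    with lim[OF \<omega>(1)] \<omega>(2) show "1 \<le> liminf (\<lambda>n. S' (initial \<omega> n))"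
      by simp
  next
    fix t :: "('p \<times> 'x) list"
    assume t: "t \<in> clearing_situations \<P>"
    have "0 \<le> S t" if "take (length s) t = s"
    proof (rule supermartingale_nonneg[OF S(1) t])
      fix \<omega> assume "\<omega> \<in> extensions \<P> t"
      then have "indicator N \<omega> \<le> liminf (\<lambda>n. S (initial \<omega> n))"
        using extensions_antimono[OF that] lim by blast
      moreover have "(0::ereal) \<le> indicator N \<omega>" by (simp add: indicator_def)
      ultimately show "0 \<le> liminf (\<lambda>n. S (initial \<omega> n))" by (rule order_trans[rotated])
    qed
    then show "0 \<le> S' t" by (simp add: S'_def)
  qed
qed

subsection \<open>Levy's zero-one law\<close>

text \<open>The strategy holds \<open>c / \<rho>\<close> times \<open>S\<close> until
  \<open>S\<close> first exceeds \<open>\<rho>\<close>. The capital then exceeds \<open>c\<close>,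
  enough to buy a fresh hedge of \<open>N\<close>, which is kept from then on.\<close>

lemma upper_prob_restart:
  assumes S: "supermartingale \<P> \<E> S" "\<And>t. t \<in> clearing_situations \<P> \<Longrightarrow> 0 \<le> S t"
    and exceeds: "\<And>\<omega>. \<omega> \<in> extensions \<P> s \<Longrightarrow> \<omega> \<in> N \<Longrightarrow>
      \<exists>n \<ge> length s. ereal \<rho> < S (initial \<omega> n)"
    and "0 < \<rho>" "0 < c" "S s \<le> ereal \<rho>"
    and less: "\<And>t. t \<in> clearing_situations \<P> \<Longrightarrow> upper_prob \<P> \<E> N t < ereal c"
  shows "upper_prob \<P> \<E> N s \<le> ereal (c / \<rho>) * S s"
proof -
  \<comment> \<open>A hedge of \<open>N\<close> costing less than \<open>c\<close> is fixed for
    every situation, because the place of the switch depends on the path.\<close>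
  define hedges where "hedges t W \<longleftrightarrow> supermartingale \<P> \<E> W \<and>
      (\<forall>u \<in> clearing_situations \<P>. 0 \<le> W u) \<and> W t < ereal c \<and>
      (\<forall>\<omega> \<in> extensions \<P> t. \<omega> \<in> N \<longrightarrow> 1 \<le> liminf (\<lambda>n. W (initial \<omega> n)))" for t W
  have "\<exists>W. hedges t W" if t: "t \<in> clearing_situations \<P>" for t
  proof -
    obtain W where "supermartingale \<P> \<E> W" "\<And>u. u \<in> clearing_situations \<P> \<Longrightarrow> 0 \<le> W u"
      "W t < ereal c" "\<And>\<omega>. \<omega> \<in> extensions \<P> t \<Longrightarrow> \<omega> \<in> N \<Longrightarrow> 1 \<le> liminf (\<lambda>n. W (initial \<omega> n))"
      using upper_prob_lessE[OF less[OF t]] by blast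
    then show ?thesis by (auto simp: hedges_def)
  qed
  then obtain W where hedges: "\<And>t. t \<in> clearing_situations \<P> \<Longrightarrow> hedges t (W t)"
    using bchoice[of "clearing_situations \<P>" hedges] by blast
  have W: "\<And>t. t \<in> clearing_situations \<P> \<Longrightarrow> supermartingale \<P> \<E> (W t)"
      "\<And>t u. t \<in> clearing_situations \<P> \<Longrightarrow> u \<in> clearing_situations \<P> \<Longrightarrow> 0 \<le> W t u"
      "\<And>t. t \<in> clearing_situations \<P> \<Longrightarrow> W t t < ereal c"
      "\<And>t \<omega>. t \<in> clearing_situations \<P> \<Longrightarrow> \<omega> \<in> extensions \<P> t \<Longrightarrow> \<omega> \<in> N \<Longrightarrow>
        1 \<le> liminf (\<lambda>n. W t (initial \<omega> n))"
    using hedges by (simp_all add: hedges_def)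
  \<comment> \<open>A hit depends on \<open>take k u\<close> only, so it persists when
    \<open>u\<close> is prolonged and the first one, \<open>\<tau> u\<close>, does not move. Without
    a hit \<open>\<tau> u\<close> is arbitrary, and \<open>T\<close> ignores it.\<close>
  define hit where
    "hit u k \<longleftrightarrow> length s \<le> k \<and> k \<le> length u \<and> ereal \<rho> < S (take k u)" for u k
  define \<tau> where "\<tau> u = (LEAST k. hit u k)" for u
  define T where
    "T u = (if \<exists>k. hit u k then W (take (\<tau> u) u) u else ereal (c / \<rho>) * S u)" for u
  have hit_append: "hit (u @ v) k" if "hit u k" for u v k
    using that by (auto simp: hit_def)
  have hit_appendD: "hit u k" if "hit (u @ v) k" "k \<le> length u" for u v k
    using that by (auto simp: hit_def)
  have \<tau>: "hit u (\<tau> u)" if "hit u k" for u k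
    using that unfolding \<tau>_def by (rule LeastI)
  have \<tau>_append: "\<tau> (u @ v) = \<tau> u" if "hit u k" for u v k
    unfolding \<tau>_def[of "u @ v"]
  proof (rule Least_equality)
    show "hit (u @ v) (\<tau> u)" using \<tau>[OF that] hit_append by blast
    fix j assume j: "hit (u @ v) j"
    show "\<tau> u \<le> j"
    proof (cases "j \<le> length u")
      case True
      then show ?thesis using hit_appendD[OF j True] unfolding \<tau>_def by (rule_tac Least_le)
    next
      case False
      then show ?thesis using \<tau>[OF that] by (simp add: hit_def)
    qed
  qed
  \<comment> \<open>By \<open>last\<close>, a hit can only occur at the end of \<open>u\<close>. The
    new hedge then starts in \<open>u\<close> itself and costs less than
    \<open>c = (c / \<rho>) * \<rho>\<close>, hence less than the capital held.\<close>
  have T_le: "T u \<le> ereal (c / \<rho>) * S u"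
    if u: "u \<in> clearing_situations \<P>" and last: "\<And>k. hit u k \<Longrightarrow> k = length u" for u
  proof (cases "\<exists>k. hit u k")
    case True
    then have \<tau>_u: "\<tau> u = length u" "hit u (length u)" using \<tau> last by metis+
    have "T u \<le> ereal (c / \<rho>) * ereal \<rho>"
      using True \<tau>_u(1) W(3)[OF u] \<open>0 < \<rho>\<close> by (simp add: T_def)
    also have "\<dots> \<le> ereal (c / \<rho>) * S u"
      using \<tau>_u(2) \<open>0 < \<rho>\<close> \<open>0 < c\<close> by (intro ereal_mult_left_mono) (auto simp: hit_def)
    finally show ?thesis .
  qed (simp add: T_def)
  \<comment> \<open>The only possible hit at \<open>s\<close> is at time \<open>length s\<close>,
    and \<open>S s \<le> \<rho>\<close> excludes it.\<close>
  have "T s = ereal (c / \<rho>) * S s"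
    using \<open>S s \<le> ereal \<rho>\<close> by (auto simp: T_def hit_def)
  moreover have "upper_prob \<P> \<E> N s \<le> T s"
  proof (rule upper_prob_le)
    show "supermartingale \<P> \<E> T"
    proof (rule supermartingaleI)
      fix u :: "('p \<times> 'x) list" and p
      assume u: "u \<in> clearing_situations \<P>" and p: "p \<in> \<P> (length u)"
      \<comment> \<open>After a switch the chosen hedge stays in force. Before it, a successor of
        \<open>u\<close> can have a hit only at its own end, so \<open>T_le\<close> bounds it by the
        scaled \<open>S\<close>.\<close>
      show "\<E> p (\<lambda>x. T (u @ [(p, x)])) \<le> T u"
      proof (cases "\<exists>k. hit u k")
        case True
        then obtain k where k: "hit u k" ..
        have "\<tau> u \<le> length u" using \<tau>[OF k] by (simp add: hit_def)
        then have "T (u @ [(p, x)]) = W (take (\<tau> u) u) (u @ [(p, x)])" for x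
          using \<tau>_append[OF k] hit_append[OF k] by (auto simp: T_def)
        then show ?thesis
          using True supermartingaleD[OF W(1)[OF clearing_take[OF u]] u p] by (simp add: T_def)
      next
        case False
        have "k = Suc (length u)" if "hit (u @ [(p, x)]) k" for k x
          using False hit_appendD[OF that] that by (fastforce simp: hit_def)
        then have "\<E> p (\<lambda>x. T (u @ [(p, x)])) \<le> \<E> p (\<lambda>x. ereal (c / \<rho>) * S (u @ [(p, x)]))"
          using u p by (intro outer_prob_content_mono[OF content[OF p]] T_le) (auto simp: clearing_snoc)
        also have "\<dots> = ereal (c / \<rho>) * \<E> p (\<lambda>x. S (u @ [(p, x)]))"
          using \<open>0 < c\<close> \<open>0 < \<rho>\<close> by (simp add: outer_prob_content_scale[OF content[OF p]])
        also have "\<dots> \<le> ereal (c / \<rho>) * S u"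
          using \<open>0 < c\<close> \<open>0 < \<rho>\<close> supermartingaleD[OF S(1) u p]
          by (intro ereal_mult_left_mono) auto
        finally show ?thesis using False by (simp add: T_def)
      qed
    qed
    show "0 \<le> T t" if "t \<in> clearing_situations \<P>" for t
      using W(2)[OF clearing_take[OF that] that] S(2)[OF that] \<open>0 < c\<close> \<open>0 < \<rho>\<close> by (simp add: T_def)
    fix \<omega> assume \<omega>: "\<omega> \<in> extensions \<P> s" "\<omega> \<in> N"
    then have \<Omega>: "\<omega> \<in> sample_space \<P>" by (simp add: extensions_def)
    obtain n where n: "length s \<le> n" "ereal \<rho> < S (initial \<omega> n)"
      using exceeds[OF \<omega>] by blast
    define t where "t = take (\<tau> (initial \<omega> n)) (initial \<omega> n)"
    have hit_n: "hit (initial \<omega> n) n"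
      using n by (simp add: hit_def)
    then have \<tau>_n: "\<tau> (initial \<omega> n) \<le> n"
      using \<tau>[OF hit_n] by (simp add: hit_def)
    \<comment> \<open>From \<open>n\<close> on the switch has happened, and \<open>T\<close> follows
      the single hedge \<open>W t\<close>, whose start \<open>t\<close> is a prefix of
      \<open>\<omega>\<close>.\<close>
    have T_eq: "T (initial \<omega> m) = W t (initial \<omega> m)" if "n \<le> m" for m
    proof -
      have "initial \<omega> m = initial \<omega> n @ drop n (initial \<omega> m)"
        using take_initial[OF that, of \<omega>] by (metis append_take_drop_id)
      then have "\<tau> (initial \<omega> m) = \<tau> (initial \<omega> n)" "hit (initial \<omega> m) n"
        using \<tau>_append[OF hit_n] hit_append[OF hit_n] by metis+
      then show ?thesis
        using \<tau>_n that by (auto simp: T_def t_def take_initial)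
    qed
    have t_eq: "t = initial \<omega> (\<tau> (initial \<omega> n))"
      using \<tau>_n by (simp add: t_def take_initial)
    have "1 \<le> liminf (\<lambda>m. W t (initial \<omega> m))"
      using W(4)[OF _ _ \<omega>(2)] extensions_initial[OF \<Omega>] clearing_initial[OF \<Omega>]
      unfolding t_eq by blast
    also have "\<dots> = liminf (\<lambda>m. T (initial \<omega> m))"
      by (intro Liminf_eq) (use T_eq in \<open>auto simp: eventually_sequentially intro: exI[of _ n]\<close>)
    finally show "1 \<le> liminf (\<lambda>m. T (initial \<omega> m))" .
  qed
  ultimately show ?thesis by simp
qed

text \<open>The supremum \<open>q\<close> runs over all situations because a restart may happen in
  any of them. This makes the estimate self-improving: hedging \<open>N\<close> everywhere at a
  price slightly above a positive \<open>q\<close> yields a uniform price strictly below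
  \<open>q\<close>.\<close>

lemma upper_prob_Levy:
  assumes r: "r < 1" and "N \<subseteq> B"
    and le: "\<And>\<omega> n. \<omega> \<in> N \<Longrightarrow> upper_prob \<P> \<E> B (initial \<omega> n) \<le> ereal r"
  shows "upper_prob \<P> \<E> N [] = 0"
proof -
  define q where "q = (SUP s \<in> clearing_situations \<P>. upper_prob \<P> \<E> N s)"
  have le_q: "upper_prob \<P> \<E> N s \<le> q" if "s \<in> clearing_situations \<P>" for s
    unfolding q_def using that by (rule SUP_upper)
  have "0 \<le> q" using le_q[of "[]"] upper_prob_nonneg[of "[]" N] by (simp add: order_trans)
  moreover have "q \<le> 1" unfolding q_def by (intro SUP_least upper_prob_le_1)
  ultimately obtain q' where q': "q = ereal q'" by (cases q) auto
  have "q' \<le> 0"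
  proof (rule ccontr)
    assume "\<not> q' \<le> 0"
    then have "0 < q'" by simp
    \<comment> \<open>The maximum with 0 makes \<open>r'\<close> positive, so that one can divide by
      it; \<open>r < r'\<close> provides a witness from the infimum defining the upper probability
      of \<open>B\<close>.\<close>
    obtain r' where r': "max r 0 < r'" "r' < 1" using dense[of "max r 0" 1] r by auto
    obtain \<rho> where \<rho>: "r' < \<rho>" "\<rho> < 1" using dense[OF r'(2)] by blast
    \<comment> \<open>As \<open>r' < \<rho>\<close>, there is room for a price \<open>c\<close>
      above \<open>q'\<close> for which \<open>c * r' / \<rho>\<close> is still below
      \<open>q'\<close>.\<close>
    have "q' < q' * \<rho> / r'" using \<open>0 < q'\<close> r' \<rho> by (simp add: field_simps)
    then obtain c where c: "q' < c" "c < q' * \<rho> / r'" using dense by blast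
    \<comment> \<open>Where no path of \<open>N\<close> runs through \<open>s\<close>, the zero
      capital suffices. Otherwise \<open>s\<close> lies on a path in \<open>N\<close>, so the bound
      on \<open>B\<close> applies at \<open>s\<close>; a hedge of \<open>B\<close> exceeds
      \<open>\<rho> < 1\<close> on all of \<open>N\<close> and drives the restart.\<close>
    have "upper_prob \<P> \<E> N s \<le> ereal (c / \<rho> * r')" if s: "s \<in> clearing_situations \<P>" for s
    proof (cases "N \<inter> extensions \<P> s = {}")
      case True
      have "upper_prob \<P> \<E> N s \<le> 0"
      proof (rule upper_prob_le)
        show "supermartingale \<P> \<E> (\<lambda>_. 0)"
          using supermartingale_const[of 0] by (simp add: zero_ereal_def)
      qed (use True in auto)
      also have "0 \<le> ereal (c / \<rho> * r')" using \<open>0 < q'\<close> c r' \<rho> by simp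
      finally show ?thesis .
    next
      case False
      then obtain \<omega> where "\<omega> \<in> N" "initial \<omega> (length s) = s" by (auto simp: extensions_def)
      then have "upper_prob \<P> \<E> B s \<le> ereal r" using le by metis
      also have "\<dots> < ereal r'" using r' by simp
      finally obtain S where S: "supermartingale \<P> \<E> S"
          "\<And>t. t \<in> clearing_situations \<P> \<Longrightarrow> 0 \<le> S t" "S s < ereal r'"
          "\<And>\<omega>. \<omega> \<in> extensions \<P> s \<Longrightarrow> \<omega> \<in> B \<Longrightarrow> 1 \<le> liminf (\<lambda>n. S (initial \<omega> n))"
        using upper_prob_lessE by metis
      have "upper_prob \<P> \<E> N s \<le> ereal (c / \<rho>) * S s"
      proof (rule upper_prob_restart[OF S(1,2)])
        show "0 < \<rho>" "0 < c" using r' \<rho> c \<open>0 < q'\<close> by auto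
        have "ereal r' < ereal \<rho>" using \<rho> by simp
        then show "S s \<le> ereal \<rho>" using S(3) by order
        show "upper_prob \<P> \<E> N t < ereal c" if "t \<in> clearing_situations \<P>" for t
          using le_q[OF that] c(1) q' by (simp add: le_less_trans)
        fix \<omega> assume \<omega>: "\<omega> \<in> extensions \<P> s" "\<omega> \<in> N"
        then have "1 \<le> liminf (\<lambda>n. S (initial \<omega> n))" using S(4) \<open>N \<subseteq> B\<close> by blast
        moreover have "ereal \<rho> < 1" using \<rho> by simp
        ultimately have "ereal \<rho> < liminf (\<lambda>n. S (initial \<omega> n))" by order
        then have "\<forall>\<^sub>F n in sequentially. ereal \<rho> < S (initial \<omega> n)" by (rule less_LiminfD)
        then obtain n0 where "\<forall>n \<ge> n0. ereal \<rho> < S (initial \<omega> n)"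
          by (auto simp: eventually_sequentially)
        then show "\<exists>n \<ge> length s. ereal \<rho> < S (initial \<omega> n)"
          by (intro exI[of _ "max n0 (length s)"]) auto
      qed auto
      also have "\<dots> \<le> ereal (c / \<rho>) * ereal r'"
        using S(3) c \<open>0 < q'\<close> r' \<rho> by (intro ereal_mult_left_mono) auto
      finally show ?thesis by simp
    qed
    then have "q \<le> ereal (c / \<rho> * r')" unfolding q_def by (intro SUP_least)
    moreover have "c / \<rho> * r' < q'" using c(2) r' \<rho> by (simp add: field_simps)
    ultimately show False using q' by simp
  qed
  then have "upper_prob \<P> \<E> N [] \<le> 0"
    using le_q[of "[]"] q' by (simp add: order_trans)
  then show ?thesis
    using upper_prob_nonneg[of "[]" N] by simp
qed

section \<open>Countable unions of null sets\<close>

text \<open>Hedges of the sets \<open>N k\<close> with geometrically decreasing initial capital are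
  added up. The sum is a supermartingale because superexpectations are countably subadditive on
  nonnegative functions.\<close>

lemma upper_prob_null_UN:
  fixes N :: "nat \<Rightarrow> (nat \<Rightarrow> 'p \<times> 'x) set"
  assumes super: "\<And>p n. p \<in> \<P> n \<Longrightarrow> superexpectation (\<E> p)"
    and null: "\<And>k. upper_prob \<P> \<E> (N k) [] = 0" and "B \<subseteq> (\<Union>k. N k)"
  shows "upper_prob \<P> \<E> B [] = 0"
proof (rule antisym)
  show "upper_prob \<P> \<E> B [] \<le> 0"
  proof (rule ereal_le_epsilon2)
    fix e :: real assume "0 < e"
    \<comment> \<open>The powers of 1/2 start with exponent 1, so the initial capitals add up to at
      most \<open>e\<close>.\<close>
    have "\<exists>S. supermartingale \<P> \<E> S \<and> (\<forall>u \<in> clearing_situations \<P>. 0 \<le> S u) \<and>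
        S [] < ereal (e * (1/2) ^ Suc k) \<and>
        (\<forall>\<omega> \<in> extensions \<P> []. \<omega> \<in> N k \<longrightarrow> 1 \<le> liminf (\<lambda>n. S (initial \<omega> n)))" for k
      using upper_prob_lessE[of "N k" "[]" "ereal (e * (1/2) ^ Suc k)"] null[of k] \<open>0 < e\<close>
      by (simp, metis)
    then obtain S where S: "\<And>k. supermartingale \<P> \<E> (S k)"
        "\<And>k u. u \<in> clearing_situations \<P> \<Longrightarrow> 0 \<le> S k u"
        "\<And>k. S k [] < ereal (e * (1/2) ^ Suc k)"
        "\<And>k \<omega>. \<omega> \<in> extensions \<P> [] \<Longrightarrow> \<omega> \<in> N k \<Longrightarrow> 1 \<le> liminf (\<lambda>n. S k (initial \<omega> n))"
      by metis
    have "upper_prob \<P> \<E> B [] \<le> (\<Sum>k. S k [])"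
    proof (rule upper_prob_le)
      show "supermartingale \<P> \<E> (\<lambda>u. \<Sum>k. S k u)"
      proof (rule supermartingaleI)
        fix u :: "('p \<times> 'x) list" and p
        assume u: "u \<in> clearing_situations \<P>" and p: "p \<in> \<P> (length u)"
        have nonneg: "0 \<le> S k (u @ [(p, x)])" for k x
          using S(2) u p by (simp add: clearing_snoc)
        \<comment> \<open>This allows the two series to be compared term by term below.\<close>
        have E_nonneg: "0 \<le> \<E> p (\<lambda>x. S k (u @ [(p, x)]))" for k
          using outer_prob_content_mono[OF content[OF p], of "\<lambda>_. 0"] nonneg
            outer_prob_content_const[OF content[OF p], of 0] by (fastforce simp: zero_ereal_def)
        have "\<E> p (\<lambda>x. \<Sum>k. S k (u @ [(p, x)])) \<le> (\<Sum>k. \<E> p (\<lambda>x. S k (u @ [(p, x)])))"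
          using super[OF p] nonneg unfolding superexpectation_def
          by (elim conjE allE[of _ "\<lambda>k x. S k (u @ [(p, x)])"]) simp
        also have "\<dots> \<le> (\<Sum>k. S k u)"
          by (intro suminf_le_pos supermartingaleD[OF S(1) u p] E_nonneg)
        finally show "\<E> p (\<lambda>x. \<Sum>k. S k (u @ [(p, x)])) \<le> (\<Sum>k. S k u)" .
      qed
      show "0 \<le> (\<Sum>k. S k t)" if "t \<in> clearing_situations \<P>" for t
        using S(2)[OF that] by (intro suminf_0_le)
      fix \<omega> assume \<omega>: "\<omega> \<in> extensions \<P> []" "\<omega> \<in> B"
      then obtain k where k: "\<omega> \<in> N k" using assms(3) by blast
      have \<Omega>: "\<omega> \<in> sample_space \<P>" using \<omega>(1) by (simp add: extensions_def)
      \<comment> \<open>All terms being nonnegative, the total dominates the one hedge responsible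
        for \<open>\<omega>\<close>.\<close>
      have "S k (initial \<omega> n) \<le> (\<Sum>k. S k (initial \<omega> n))" for n
        using suminf_upper[of "\<lambda>k. S k (initial \<omega> n)" "Suc k"]
          sum_nonneg[of "{..<k}" "\<lambda>k. S k (initial \<omega> n)"] S(2)[OF clearing_initial[OF \<Omega>]]
        by (simp add: add_increasing order_trans[rotated])
      then have "liminf (\<lambda>n. S k (initial \<omega> n)) \<le> liminf (\<lambda>n. \<Sum>k. S k (initial \<omega> n))"
        by (intro Liminf_mono always_eventually) simp
      then show "1 \<le> liminf (\<lambda>n. \<Sum>k. S k (initial \<omega> n))"
        using S(4)[OF \<omega>(1) k] by (rule order_trans[rotated])
    qed
    also have "\<dots> \<le> (\<Sum>k. ereal (e * (1/2) ^ Suc k))"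
      using S(2)[OF clearing_Nil] S(3) by (intro suminf_le_pos) (auto intro: less_imp_le)
    also have "\<dots> = ereal e"
      using sums_mult[OF power_half_series, of e] by (intro sums_unique[symmetric]) (simp add: sums_ereal)
    finally show "upper_prob \<P> \<E> B [] \<le> 0 + ereal e" by simp
  qed
qed (simp add: upper_prob_nonneg)

end

section \<open>Zero-one law for tail sets\<close>

theorem corollary9:
  fixes \<P> :: "nat \<Rightarrow> 'p set"
    and \<E> :: "'p \<Rightarrow> ('x \<Rightarrow> ereal) \<Rightarrow> ereal"
    and \<Phi> :: "'x list \<Rightarrow> 'p"
    and \<delta> :: real
    and A :: "(nat \<Rightarrow> 'x) set"
  assumes "\<And>n. \<P> n \<noteq> {}"
    and "\<And>p. p \<in> (\<Union>n. \<P> n) \<Longrightarrow> superexpectation (\<E> p)"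
    and "0 \<le> \<delta>" and "\<delta> < 1"
    and "forecasting_system \<P> \<Phi>"
    and "delta_mixing \<P> \<E> \<delta> \<Phi>"
    and "tail_set A"
  shows "upper_prob_forecast \<P> \<E> \<Phi> A = 0 \<or> upper_prob_forecast \<P> \<E> \<Phi> A \<ge> ereal (1 - \<delta>)"
proof (cases "upper_prob_forecast \<P> \<E> \<Phi> A \<ge> ereal (1 - \<delta>)")
  case False
  interpret forecasting_game \<P> \<E>
    using assms(1,2) by unfold_locales (auto simp: superexpectation_def)
  define P where "P \<chi> n = upper_prob_forecast_cond \<P> \<E> \<Phi> A \<chi> n" for \<chi> n
  define \<pi> where "\<pi> = upper_prob_forecast \<P> \<E> \<Phi> A"
  define G where "G n = {\<chi>. P \<chi> n - \<pi> \<le> ereal \<delta>}" for n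
  have "0 \<le> \<pi>" by (simp add: \<pi>_def upper_prob_forecast_def upper_prob_nonneg)
  moreover have "\<pi> < ereal (1 - \<delta>)" using False by (simp add: \<pi>_def)
  \<comment> \<open>Both bounds together make \<open>\<pi>\<close> a real number, so
    \<open>\<pi>\<close> can be moved across the mixing inequality.\<close>
  ultimately obtain r where r: "\<pi> = ereal r" "r < 1 - \<delta>" by (cases \<pi>) auto
  obtain a where mix: "\<And>n A. 1 \<le> n \<Longrightarrow> A \<in> tail_from (n + a n) \<Longrightarrow> almost_surely \<P> \<E> \<Phi>
      {\<chi>. upper_prob_forecast_cond \<P> \<E> \<Phi> A \<chi> n - upper_prob_forecast \<P> \<E> \<Phi> A \<le> ereal \<delta>}"
    using assms(6) unfolding delta_mixing_def by blast
  have null: "upper_prob \<P> \<E> (with_forecasts \<Phi> ` (- G n)) [] = 0" if "1 \<le> n" for n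
  proof -
    \<comment> \<open>A tail set lies in every \<open>tail_from\<close> class of positive index, so
      mixing applies to \<open>A\<close> itself at every time \<open>n \<ge> 1\<close>, whatever the
      gap \<open>a n\<close>.\<close>
    have "A \<in> tail_from (n + a n)" using assms(7) that by (auto simp: tail_set_def)
    then show ?thesis
      using mix[OF that] by (simp add: almost_surely_def upper_prob_forecast_def G_def P_def \<pi>_def)
  qed
  \<comment> \<open>On these paths all mixing bounds hold at once and keep the conditional upper
    probabilities of \<open>A\<close> below \<open>r + \<delta> < 1\<close>, or equal to it.\<close>
  define N where "N = with_forecasts \<Phi> ` {\<chi> \<in> A. \<forall>n \<ge> 1. \<chi> \<in> G n}"
  have "upper_prob \<P> \<E> N [] = 0"
  proof (rule upper_prob_Levy)
    show "r + \<delta> < 1" using r by simp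
    show "N \<subseteq> with_forecasts \<Phi> ` A" by (auto simp: N_def)
    fix \<omega> n assume "\<omega> \<in> N"
    then obtain \<chi> where \<chi>: "\<omega> = with_forecasts \<Phi> \<chi>" "\<And>n. 1 \<le> n \<Longrightarrow> \<chi> \<in> G n"
      by (auto simp: N_def)
    \<comment> \<open>Mixing starts at \<open>n = 1\<close>. At time 0 the conditional upper
      probability is \<open>\<pi>\<close> itself, and \<open>0 \<le> \<delta>\<close> gives the
      bound.\<close>
    have "P \<chi> n \<le> ereal (r + \<delta>)"
    proof (cases "n = 0")
      case True
      then have "P \<chi> n = \<pi>"
        by (simp add: P_def \<pi>_def upper_prob_forecast_def upper_prob_forecast_cond_def initial_def)
      then show ?thesis using r assms(3) by simp
    next
      case False
      then have "P \<chi> n - \<pi> \<le> ereal \<delta>" using \<chi>(2)[of n] by (simp add: G_def)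
      then show ?thesis using r by (cases "P \<chi> n") auto
    qed
    then show "upper_prob \<P> \<E> (with_forecasts \<Phi> ` A) (initial \<omega> n) \<le> ereal (r + \<delta>)"
      by (simp add: P_def upper_prob_forecast_cond_def \<chi>(1))
  qed
  \<comment> \<open>Index 0, where mixing supplies no exceptional set, is given to \<open>N\<close>,
    so that one sequence of null sets covers the image of \<open>A\<close>.\<close>
  then have N_null: "upper_prob \<P> \<E> (if k = 0 then N else with_forecasts \<Phi> ` (- G k)) [] = 0" for k
    using null by simp
  have cover: "with_forecasts \<Phi> ` A \<subseteq> (\<Union>k. if k = 0 then N else with_forecasts \<Phi> ` (- G k))"
  proof (rule image_subsetI)
    fix \<chi> assume \<chi>: "\<chi> \<in> A"
    have "\<exists>k. with_forecasts \<Phi> \<chi> \<in> (if k = 0 then N else with_forecasts \<Phi> ` (- G k))"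
    proof (cases "\<forall>n \<ge> 1. \<chi> \<in> G n")
      case True
      then show ?thesis using \<chi> by (intro exI[of _ 0]) (auto simp: N_def)
    next
      case False
      then obtain n where "1 \<le> n" "\<chi> \<notin> G n" by blast
      then show ?thesis by (intro exI[of _ n]) auto
    qed
    then show "with_forecasts \<Phi> \<chi> \<in> (\<Union>k. if k = 0 then N else with_forecasts \<Phi> ` (- G k))"
      by blast
  qed
  have "upper_prob \<P> \<E> (with_forecasts \<Phi> ` A) [] = 0"
    using assms(2) by (intro upper_prob_null_UN[OF _ N_null cover]) auto
  then show ?thesis by (simp add: upper_prob_forecast_def)
qed simp

end
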